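(* Let $f\in H(\mathbb{D})$ have the power series expansion $f(z)=\sum_{k=0}^\infty a_k z^{n_k}$, where $a_k\in\mathbb{C}$ and $(n_k)_{k\ge 0}$ is a strictly increasing sequence of positive integers, and suppose there exist $\alpha>1$ and $\beta>1$ such that $n_k^{\alpha}\le n_{k+1}\le n_k^{\alpha\beta}$ for all $k$. Then $f\in X_0$ if and only if $$\lim_{k\to\infty}\frac{|a_k|}{\log n_k}=0.$$ Furthermore, the space $X_0$ is not a subset of the Bloch space $\mathcal{B}$.
   Context: Let $\mathbb{D}=\{z\in\mathbb{C}:|z|<1\}$, let $H(\mathbb{D})$ be the space of analytic functions on $\mathbb{D}$, and let $dA$ be the area measure on $\mathbb{D}$ normalized so that $A(\mathbb{D})=1$. For $f\in H(\mathbb{D})$ put $\|f\|_{A^1}=\int_{\mathbb{D}}|f(z)|\,dA(z)$. For $w\in\mathbb{D}$ let $k_w(z)=\frac{1}{(1-\overline{w}z)^2}$, $z\in\mathbb{D}$ (the reproducing kernel of the Bergman space $A^2$). The space $X$ consists of all $f\in H(\mathbb{D})$ with $$\|f\|_X=\sup_{z\in\mathbb{D}}|f(z)|\,\|k_z\|_{A^1}^{-1}<\infty,$$ and $X_0$ consists of all $f\in X$ such that $$\lim_{|z|\to 1}|f(z)|\,\|k_z\|_{A^1}^{-1}=0.$$ The Bloch space $\mathcal{B}$ consists of all $f\in H(\mathbb{D})$ with $\sup_{z\in\mathbb{D}}(1-|z|^2)|f'(z)|<\infty$. *)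

theory Defs
  imports "HOL-Complex_Analysis.Complex_Analysis"
begin

text \<open>
  Functions on the unit disk are represented by total functions on the complex plane; only their
  values on the disk matter in any of the definitions below.
\<close>

abbreviation unit_disk :: "complex set" where
  "unit_disk \<equiv> ball 0 1"

text \<open>Lebesgue measure on the disk, normalized to total mass 1.\<close>

definition disk_area :: "complex measure" where
  "disk_area = uniform_measure lborel unit_disk"

text \<open>
  This is a Bochner integral, hence 0 for functions that are not integrable. Below it is only
  applied to the kernels \<open>bergman_kernel w\<close> with \<open>w\<close> in the disk, which are
  continuous and bounded there.
\<close>

definition A1_norm :: "(complex \<Rightarrow> complex) \<Rightarrow> real" where
  "A1_norm f = (\<integral>z. cmod (f z) \<partial>disk_area)"

definition bergman_kernel :: "complex \<Rightarrow> complex \<Rightarrow> complex" where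
  "bergman_kernel w z = 1 / (1 - cnj w * z)\<^sup>2"

definition X_space :: "(complex \<Rightarrow> complex) set" where
  "X_space = {f. f holomorphic_on unit_disk \<and>
     bdd_above ((\<lambda>z. cmod (f z) * inverse (A1_norm (bergman_kernel z))) ` unit_disk)}"

text \<open>The filter expresses \<open>|z| \<rightarrow> 1\<close> from inside the disk, uniformly in the argument of \<open>z\<close>.\<close>

definition X0_space :: "(complex \<Rightarrow> complex) set" where
  "X0_space = {f \<in> X_space.
     ((\<lambda>z. cmod (f z) * inverse (A1_norm (bergman_kernel z))) \<longlongrightarrow> 0)
       (filtercomap cmod (at_left 1))}"

definition Bloch_space :: "(complex \<Rightarrow> complex) set" where
  "Bloch_space = {f. f holomorphic_on unit_disk \<and>
     bdd_above ((\<lambda>z. (1 - (cmod z)\<^sup>2) * cmod (deriv f z)) ` unit_disk)}"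

end

theory Submission
  imports Defs "HOL-Real_Asymp.Real_Asymp"
begin

text \<open>
  Dyadic decomposition of the disk around \<open>1 / cnj w\<close> shows that
  \<open>A1_norm (bergman_kernel w)\<close> is comparable to \<open>- ln (1 - cmod w)\<close> near the
  boundary. Cauchy's inequality on the circle of radius \<open>1 - 1 / (2 * m)\<close> then bounds the
  \<open>m\<close>-th Taylor coefficient of a function in \<open>X0_space\<close> by \<open>o(ln m)\<close>, and of a
  Bloch function by \<open>O(1)\<close>. Conversely, since \<open>n (k + 1) \<ge> n k powr \<alpha>\<close>, the number
  \<open>ln (n k)\<close> is at most a constant times the sum of \<open>1 / j\<close> over
  \<open>n (k - 1) \<le> j < n k\<close>, so that \<open>\<Sum>k. ln (n k) * r ^ n k\<close> is dominated by
  \<open>\<Sum>j. r ^ j / j = - ln (1 - r)\<close>. The series with coefficients \<open>k\<close> and exponents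
  \<open>2 ^ 2 ^ k\<close> separates the two spaces.
\<close>

section \<open>Normalized area measure of balls and almost-everywhere statements on the disk\<close>

lemma sets_disk_area [measurable_cong]: "sets disk_area = sets borel"
  by (simp add: disk_area_def)

lemma emeasure_unit_disk: "emeasure lborel unit_disk \<noteq> 0" "emeasure lborel unit_disk \<noteq> \<infinity>"
proof -
  have "measure lborel unit_disk > 0"
    by (rule content_ball_pos) simp
  then show "emeasure lborel unit_disk \<noteq> 0"
    by (metis enn2real_0 measure_def less_irrefl)
  show "emeasure lborel unit_disk \<noteq> \<infinity>"
    using emeasure_lborel_ball_finite[of "0::complex" 1] by (simp add: less_top)
qed

lemma finite_measure_disk_area: "finite_measure disk_area"
proof
  have "emeasure disk_area (space disk_area) = emeasure lborel unit_disk / emeasure lborel unit_disk"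
    by (simp add: disk_area_def)
  also have "\<dots> = 1"
    using emeasure_unit_disk by (simp add: ennreal_divide_self less_top)
  finally show "emeasure disk_area (space disk_area) \<noteq> \<infinity>"
    by simp
qed

lemma AE_disk_areaI: "(\<And>z. z \<in> unit_disk \<Longrightarrow> P z) \<Longrightarrow> AE z in disk_area. P z"
  unfolding disk_area_def by (rule AE_uniform_measureI) auto

lemma measure_disk_area_ball:
  assumes "r \<ge> 0" "ball c r \<subseteq> unit_disk"
  shows "measure disk_area (ball c r) = r\<^sup>2"
proof -
  have "measure disk_area (ball c r) = measure lborel (unit_disk \<inter> ball c r) / measure lborel unit_disk"
    unfolding disk_area_def using emeasure_unit_disk by (intro measure_uniform_measure) auto
  also have "unit_disk \<inter> ball c r = ball c r"
    using assms by auto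
  finally show ?thesis
    using content_ball_conv_unit_ball[OF assms(1), of c] content_ball_pos[of 1 "0::complex"] by simp
qed

text \<open>Serves balls that stick out of the unit disk: only the part inside carries mass, so an
  inequality is all that can be claimed. The balls centred at \<open>1 / cnj w\<close> in the upper
  bound for the kernel are of this kind.\<close>

lemma measure_disk_area_cball_le:
  assumes "r \<ge> 0"
  shows "measure disk_area (cball c r) \<le> r\<^sup>2"
proof -
  have "measure disk_area (cball c r) = measure lborel (unit_disk \<inter> cball c r) / measure lborel unit_disk"
    unfolding disk_area_def using emeasure_unit_disk by (intro measure_uniform_measure) auto
  also have "\<dots> \<le> measure lborel (cball c r) / measure lborel unit_disk"
    using content_ball_pos[of 1 "0::complex"] emeasure_lborel_cball_finite[of c r]
    by (intro divide_right_mono measure_mono_fmeasurable) (auto simp: fmeasurable_def)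
  finally show ?thesis
    using content_ball_conv_unit_ball[OF assms, of c] content_ball_pos[of 1 "0::complex"]
    by (simp add: content_cball_conv_ball)
qed

section \<open>Two-sided logarithmic estimate for the A1 norm of the Bergman kernel\<close>

lemma two_power_power2: "(2 ^ k)\<^sup>2 = (4 :: real) ^ k"
  by (simp add: power2_eq_square flip: power_mult_distrib)

lemma cmod_one_minus_mult_ge:
  assumes "z \<in> unit_disk"
  shows "1 - cmod w \<le> cmod (1 - cnj w * z)"
proof -
  have "cmod (cnj w * z) \<le> cmod w"
    using assms by (simp add: norm_mult mult_left_le)
  then show ?thesis
    using norm_triangle_ineq2[of 1 "cnj w * z"] by simp
qed

lemma cmod_one_minus_mult_le:
  assumes "w \<in> unit_disk" "z \<in> unit_disk"
  shows "cmod (1 - cnj w * z) \<le> 2"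
proof -
  have "cmod (cnj w * z) \<le> 1"
    using assms by (simp add: norm_mult mult_le_one)
  then show ?thesis
    using norm_triangle_ineq4[of 1 "cnj w * z"] by simp
qed

lemma cmod_bergman_kernel: "cmod (bergman_kernel w z) = 1 / (cmod (1 - cnj w * z))\<^sup>2"
  by (simp add: bergman_kernel_def norm_divide norm_power)

text \<open>Rules out the default value 0 of the Bochner integral: for fixed \<open>w\<close> in the
  disk the kernel is bounded there by the inverse square of \<open>1 - cmod w\<close>, and the
  measure is finite.\<close>

lemma integrable_bergman_kernel:
  assumes "w \<in> unit_disk"
  shows "integrable disk_area (\<lambda>z. cmod (bergman_kernel w z))"
proof (rule finite_measure.integrable_const_bound[OF finite_measure_disk_area])
  show "AE z in disk_area. norm (cmod (bergman_kernel w z)) \<le> 1 / (1 - cmod w)\<^sup>2"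
  proof (rule AE_disk_areaI)
    fix z assume "z \<in> unit_disk"
    then show "norm (cmod (bergman_kernel w z)) \<le> 1 / (1 - cmod w)\<^sup>2"
      using cmod_one_minus_mult_ge[of z w] assms
      by (auto simp: cmod_bergman_kernel intro!: divide_left_mono power_mono mult_pos_pos)
  qed
  show "(\<lambda>z. cmod (bergman_kernel w z)) \<in> borel_measurable disk_area"
    unfolding bergman_kernel_def by measurable
qed

text \<open>Since the denominator of the kernel has modulus at most 4, the norm stays away from 0.
  Hence \<open>inverse (A1_norm (bergman_kernel w))\<close> is a genuine reciprocal and is at most 4
  everywhere on the disk.\<close>

lemma A1_norm_bergman_kernel_ge:
  assumes "w \<in> unit_disk"
  shows "1 / 4 \<le> A1_norm (bergman_kernel w)"
proof -
  interpret finite_measure disk_area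
    by (rule finite_measure_disk_area)
  have "1 / 4 = (1 / 4) * measure disk_area unit_disk"
    using measure_disk_area_ball[of 1 0] by simp
  also have "\<dots> = (\<integral>z. 1 / 4 * indicator unit_disk z \<partial>disk_area)"
    by (simp add: sets_disk_area emeasure_eq_measure)
  also have "\<dots> \<le> (\<integral>z. cmod (bergman_kernel w z) \<partial>disk_area)"
  proof (rule integral_mono_AE)
    show "AE z in disk_area. 1 / 4 * indicator unit_disk z \<le> cmod (bergman_kernel w z)"
    proof (rule AE_disk_areaI)
      fix z assume z: "z \<in> unit_disk"
      have "1 / 2\<^sup>2 \<le> 1 / (cmod (1 - cnj w * z))\<^sup>2"
        using cmod_one_minus_mult_le[OF assms z] cmod_one_minus_mult_ge[OF z, of w] assms
        by (intro divide_left_mono power_mono mult_pos_pos) auto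
      then show "1 / 4 * indicator unit_disk z \<le> cmod (bergman_kernel w z)"
        using z by (simp add: cmod_bergman_kernel)
    qed
  qed (auto simp: sets_disk_area emeasure_eq_measure integrable_bergman_kernel[OF assms])
  finally show ?thesis
    by (simp add: A1_norm_def)
qed

text \<open>Each of the \<open>K + 1\<close> dyadic scales of \<open>cmod (1 - cnj w * z)\<close>
  contributes at most 16. The hypothesis on \<open>K\<close> makes the finest scale at most
  \<open>1 - cmod w\<close>, a lower bound for that modulus, so no point of the disk is
  missed.\<close>

lemma A1_norm_bergman_kernel_le:
  assumes w: "w \<in> unit_disk" "1 / 2 \<le> cmod w" and K: "1 \<le> 2 ^ K * (1 - cmod w)"
  shows "A1_norm (bergman_kernel w) \<le> 16 * (real K + 1)"
proof -
  interpret finite_measure disk_area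
    by (rule finite_measure_disk_area)
  \<comment> \<open>By \<open>A_iff\<close> below, this ball is the sublevel set of
    \<open>cmod (1 - cnj w * z)\<close> at height \<open>2 / 2 ^ k\<close>.\<close>
  define A where "A k = cball (1 / cnj w) (2 / (2 ^ k * cmod w))" for k :: nat
  have w0: "w \<noteq> 0"
    using w by auto
  have A_iff: "z \<in> A k \<longleftrightarrow> cmod (1 - cnj w * z) \<le> 2 / 2 ^ k" for z k
  proof -
    have "1 / cnj w - z = (1 - cnj w * z) / cnj w"
      using w0 by (simp add: field_simps)
    then have "dist (1 / cnj w) z = cmod (1 - cnj w * z) / cmod w"
      by (simp add: dist_norm norm_divide)
    then have "z \<in> A k \<longleftrightarrow> cmod (1 - cnj w * z) / cmod w \<le> (2 / 2 ^ k) / cmod w"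
      by (simp add: A_def)
    then show ?thesis
      using w0 by (simp only: divide_le_cancel) simp
  qed
  have measA: "4 ^ k * measure disk_area (A k) \<le> 16" for k
  proof -
    have "4 ^ k * measure disk_area (A k) \<le> 4 ^ k * (2 / (2 ^ k * cmod w))\<^sup>2"
      unfolding A_def by (intro mult_left_mono measure_disk_area_cball_le) auto
    also have "\<dots> = 4 / (cmod w)\<^sup>2"
      by (simp add: power_divide power_mult_distrib two_power_power2)
    also have "\<dots> \<le> 4 / (1 / 2)\<^sup>2"
      using w by (intro divide_left_mono power_mono mult_pos_pos) auto
    finally show ?thesis
      by (simp add: power2_eq_square)
  qed
  have sets_A: "A k \<in> sets disk_area" for k
    by (simp add: A_def sets_disk_area)
  have int: "integrable disk_area (\<lambda>z. \<Sum>k\<le>K. 4 ^ k * indicator (A k) z :: real)"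
    by (intro Bochner_Integration.integrable_sum) (simp add: sets_A emeasure_eq_measure)
  have "A1_norm (bergman_kernel w) \<le> (\<integral>z. (\<Sum>k\<le>K. 4 ^ k * indicator (A k) z) \<partial>disk_area)"
    unfolding A1_norm_def
  proof (rule integral_mono_AE)
    show "AE z in disk_area. cmod (bergman_kernel w z) \<le> (\<Sum>k\<le>K. 4 ^ k * indicator (A k) z)"
    proof (rule AE_disk_areaI)
      fix z assume z: "z \<in> unit_disk"
      define s where "s = cmod (1 - cnj w * z)"
      have s: "1 - cmod w \<le> s" "s \<le> 2"
        using cmod_one_minus_mult_le[OF w(1) z] cmod_one_minus_mult_ge[OF z, of w]
        by (simp_all add: s_def)
      then have s0: "s > 0"
        using w by auto
      have K': "1 \<le> 2 ^ K * s"
        using K s by (meson mult_left_mono order_trans zero_le_numeral zero_le_power)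
      \<comment> \<open>Leastness of \<open>k\<close> gives the upper bound
        \<open>s \<le> 2 / 2 ^ k\<close>, which puts \<open>z\<close> into \<open>A k\<close>; the
        defining inequality gives that the kernel is at most \<open>4 ^ k\<close>. For
        \<open>k = 0\<close> the upper bound is just \<open>s \<le> 2\<close>.\<close>
      define k where "k = (LEAST k. 1 \<le> 2 ^ k * s)"
      have k: "1 \<le> 2 ^ k * s" and kK: "k \<le> K"
        unfolding k_def using K' by (auto intro: LeastI Least_le)
      have "s \<le> 2 / 2 ^ k"
      proof (cases k)
        case (Suc l)
        then have "\<not> 1 \<le> 2 ^ l * s"
          unfolding k_def by (intro not_less_Least) simp
        then show ?thesis
          using Suc by (simp add: field_simps)
      qed (use s in auto)
      then have zA: "z \<in> A k"
        by (simp add: A_iff s_def)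
      have "1\<^sup>2 \<le> (2 ^ k * s)\<^sup>2"
        using k by (intro power_mono) auto
      then have "1 \<le> 4 ^ k * s\<^sup>2"
        by (simp add: power_mult_distrib two_power_power2)
      then have "1 / s\<^sup>2 \<le> 4 ^ k * indicator (A k) z"
        using s0 zA by (simp add: field_simps)
      also have "\<dots> \<le> (\<Sum>k\<le>K. 4 ^ k * indicator (A k) z)"
        using kK by (intro member_le_sum) auto
      finally show "cmod (bergman_kernel w z) \<le> (\<Sum>k\<le>K. 4 ^ k * indicator (A k) z)"
        by (simp add: cmod_bergman_kernel s_def)
    qed
  qed (fact integrable_bergman_kernel[OF w(1)] int)+
  also have "\<dots> = (\<Sum>k\<le>K. 4 ^ k * measure disk_area (A k))"
    by (subst Bochner_Integration.integral_sum) (auto simp: sets_A emeasure_eq_measure)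
  also have "\<dots> \<le> (\<Sum>k\<le>K. 16)"
    by (intro sum_mono measA)
  finally show ?thesis
    by (simp add: algebra_simps)
qed

text \<open>A geometric sum is comparable to its largest term. This absorbs any overlap among the
  balls of the next lemma.\<close>

lemma sum_power_four_le:
  fixes M :: real
  assumes "\<And>k. k \<in> S \<Longrightarrow> 4 ^ k \<le> M" "M \<ge> 0" "finite S"
  shows "(\<Sum>k\<in>S. 4 ^ k) \<le> 4 / 3 * M"
proof (cases "S = {}")
  case False
  define m where "m = Max S"
  have "(\<Sum>k\<in>S. 4 ^ k) \<le> (\<Sum>k\<le>m. 4 ^ k :: real)"
    using assms by (intro sum_mono2) (auto simp: m_def)
  also have "\<dots> \<le> 4 / 3 * 4 ^ m"
    by (induction m) auto
  also have "\<dots> \<le> 4 / 3 * M"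
    using assms False by (simp add: m_def)
  finally show ?thesis .
qed (use assms in auto)

text \<open>Each scale \<open>k\<close> up to \<open>K\<close> supplies a ball of radius of order
  \<open>1 / 2 ^ k\<close> on which the kernel is at least of order \<open>4 ^ k\<close>, so all
  scales contribute equally. The hypothesis on \<open>K\<close> keeps these balls inside the
  disk.\<close>

lemma A1_norm_bergman_kernel_ge_dyadic:
  assumes w: "w \<in> unit_disk" "1 / 2 \<le> cmod w" and K: "2 ^ K * (1 - cmod w) \<le> 1 / 2"
  shows "3 / 100 * (real K + 1) \<le> A1_norm (bergman_kernel w)"
proof -
  interpret finite_measure disk_area
    by (rule finite_measure_disk_area)
  \<comment> \<open>The centre is the point where \<open>1 - cnj w * z\<close> equals
    \<open>1 / 2 ^ k\<close>; moving by a quarter of that amount changes the modulus by a factor of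
    at most 5/4.\<close>
  define B where "B k = ball ((1 - 1 / 2 ^ k) / cnj w) (1 / (4 * 2 ^ k))" for k :: nat
  have w0: "w \<noteq> 0"
    using w by auto
  have B_imp: "cmod (1 - cnj w * z) \<le> 5 / 4 / 2 ^ k" if "z \<in> B k" for z k
  proof -
    have "(1 - cnj w * z) - 1 / 2 ^ k = cnj w * ((1 - 1 / 2 ^ k) / cnj w - z)"
      using w0 by (simp add: field_simps)
    then have "cmod ((1 - cnj w * z) - 1 / 2 ^ k) = cmod w * dist ((1 - 1 / 2 ^ k) / cnj w) z"
      by (simp add: dist_norm norm_mult)
    also have "\<dots> \<le> 1 * (1 / (4 * 2 ^ k))"
      using that w by (intro mult_mono) (auto simp: B_def)
    finally have "cmod (1 - cnj w * z) \<le> cmod (1 / 2 ^ k) + 1 / (4 * 2 ^ k)"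
      using norm_triangle_sub[of "1 - cnj w * z" "1 / 2 ^ k"] by linarith
    also have "cmod (1 / 2 ^ k) = 1 / 2 ^ k"
      by (simp add: norm_divide norm_power)
    finally show ?thesis
      by (simp add: field_simps)
  qed
  have B_sub: "B k \<subseteq> unit_disk" if "k \<le> K" for k
  proof
    fix z assume "z \<in> B k"
    define t :: real where "t = 1 / 2 ^ k"
    have t: "0 < t" "t \<le> 1"
      by (auto simp: t_def)
    have "2 ^ k * (1 - cmod w) \<le> 2 ^ K * (1 - cmod w)"
      using that w by (intro mult_right_mono power_increasing) auto
    then have "2 ^ k * (1 - cmod w) \<le> 1 / 2"
      using K by linarith
    then have wt: "1 - t / 2 \<le> cmod w"
      by (simp add: t_def field_simps)
    have "dist (complex_of_real (1 - t) / cnj w) z < t / 4"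
      using \<open>z \<in> B k\<close> by (simp add: B_def t_def)
    then have "cmod z < cmod (complex_of_real (1 - t) / cnj w) + t / 4"
      using norm_triangle_ineq3[of z "complex_of_real (1 - t) / cnj w"] by (simp add: dist_norm norm_minus_commute)
    also have "cmod (complex_of_real (1 - t) / cnj w) = (1 - t) / cmod w"
      using t by (simp add: norm_divide del: of_real_diff)
    also have "\<dots> \<le> (1 - t) / (1 - t / 2)"
      using t wt w0 by (intro divide_left_mono mult_pos_pos) auto
    \<comment> \<open>Equivalent to \<open>1 - t\<close> being at most the square of
      \<open>1 - t / 2\<close>. The remaining slack \<open>t / 2\<close> exceeds the radius
      \<open>t / 4\<close>.\<close>
    also have "\<dots> \<le> 1 - t / 2"
      using t by (simp add: field_simps power2_eq_square)
    finally show "z \<in> unit_disk"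
      using t by simp
  qed
  have sets_B: "B k \<in> sets disk_area" for k
    by (simp add: B_def sets_disk_area)
  have measB: "4 ^ k * measure disk_area (B k) = 1 / 16" if "k \<le> K" for k
    using B_sub[OF that] unfolding B_def
    by (simp add: measure_disk_area_ball power_divide power_mult_distrib two_power_power2)
  have int: "integrable disk_area (\<lambda>z. \<Sum>k\<le>K. 4 ^ k * indicator (B k) z :: real)"
    by (intro Bochner_Integration.integrable_sum) (simp add: sets_B emeasure_eq_measure)
  \<comment> \<open>The factor 12/25 is the reciprocal of 4/3 * 25/16, the loss from the geometric
    sum and from the 5/4 in \<open>B_imp\<close>. With mass 1/16 per scale it yields 3/100.\<close>
  have "3 / 100 * (real K + 1) = 12 / 25 * (\<Sum>k\<le>K. 4 ^ k * measure disk_area (B k))"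
    by (simp add: measB)
  also have "\<dots> = (\<integral>z. 12 / 25 * (\<Sum>k\<le>K. 4 ^ k * indicator (B k) z) \<partial>disk_area)"
    by (subst integral_mult_right_zero, subst Bochner_Integration.integral_sum)
      (auto simp: sets_B emeasure_eq_measure)
  also have "\<dots> \<le> A1_norm (bergman_kernel w)"
    unfolding A1_norm_def
  proof (rule integral_mono_AE)
    show "AE z in disk_area. 12 / 25 * (\<Sum>k\<le>K. 4 ^ k * indicator (B k) z) \<le> cmod (bergman_kernel w z)"
    proof (rule AE_disk_areaI)
      fix z assume z: "z \<in> unit_disk"
      define s where "s = cmod (1 - cnj w * z)"
      have s0: "s > 0"
        using cmod_one_minus_mult_ge[OF z, of w] w by (auto simp: s_def)
      have "(\<Sum>k\<le>K. 4 ^ k * indicator (B k) z) = (\<Sum>k\<le>K. if z \<in> B k then 4 ^ k else 0 :: real)"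
        by (intro sum.cong) auto
      also have "\<dots> = (\<Sum>k\<in>{k\<in>{..K}. z \<in> B k}. 4 ^ k)"
        by (rule sum.inter_filter[symmetric]) simp
      also have "\<dots> \<le> 4 / 3 * (25 / 16 / s\<^sup>2)"
      proof (rule sum_power_four_le)
        fix k assume "k \<in> {k\<in>{..K}. z \<in> B k}"
        then have "s \<le> 5 / 4 / 2 ^ k"
          using B_imp by (simp add: s_def)
        then have "(2 ^ k * s)\<^sup>2 \<le> (5 / 4)\<^sup>2"
          using s0 by (intro power_mono) (auto simp: field_simps)
        then have "4 ^ k * s\<^sup>2 \<le> 25 / 16"
          by (simp add: power_mult_distrib two_power_power2 power_divide)
        then show "4 ^ k \<le> 25 / 16 / s\<^sup>2"
          using s0 by (simp add: field_simps)
      qed auto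
      finally show "12 / 25 * (\<Sum>k\<le>K. 4 ^ k * indicator (B k) z) \<le> cmod (bergman_kernel w z)"
        by (simp add: cmod_bergman_kernel s_def)
    qed
  qed (use integrable_bergman_kernel[OF w(1)] int in simp_all)
  finally show ?thesis .
qed

lemma A1_norm_bergman_kernel_ge_ln:
  assumes "w \<in> unit_disk" "1 / 2 \<le> cmod w"
  shows "- ln (1 - cmod w) / 100 \<le> A1_norm (bergman_kernel w)"
proof -
  define x where "x = 1 / (2 * (1 - cmod w))"
  have x: "1 \<le> x"
    using assms by (simp add: x_def field_simps)
  \<comment> \<open>The largest exponent that the dyadic bound admits. It satisfies
    \<open>- ln (1 - cmod w) \<le> real K + 2\<close>, and K + 2 is at most 3 (K + 1), whence the
    constant 1/100.\<close>
  define K where "K = nat \<lfloor>log 2 x\<rfloor>"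
  have K: "real K \<le> log 2 x" "log 2 x < real K + 1"
    using x by (auto simp: K_def)
  have "2 ^ K \<le> x"
    using K x by (simp add: le_log_iff powr_realpow)
  then have "2 ^ K * (1 - cmod w) \<le> 1 / 2"
    using assms by (simp add: x_def field_simps)
  note * = A1_norm_bergman_kernel_ge_dyadic[OF assms this]
  have "x < 2 ^ Suc K"
    using K x by (simp add: log_less_iff powr_realpow powr_add)
  then have "ln x < ln (2 ^ Suc K)"
    using x by (intro ln_less_cancel_iff[THEN iffD2]) auto
  also have "\<dots> = (real K + 1) * ln 2"
    by (simp add: ln_realpow del: power_Suc)
  also have "\<dots> \<le> real K + 1"
    using ln_2_less_1 by (simp add: mult_left_le)
  finally have "ln x < real K + 1" .
  moreover have "ln x = - ln (1 - cmod w) - ln 2"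
  proof -
    have "ln x = - ln (2 * (1 - cmod w))"
      using assms by (simp add: x_def ln_div)
    also have "ln (2 * (1 - cmod w)) = ln 2 + ln (1 - cmod w)"
      using assms by (intro ln_mult_pos) auto
    finally show ?thesis
      by simp
  qed
  ultimately have "- ln (1 - cmod w) \<le> real K + 2"
    using ln_2_less_1 by linarith
  then show ?thesis
    using * of_nat_0_le_iff[of K, where ?'a = real] by argo
qed

section \<open>Gap series as power series: Taylor coefficients and holomorphy\<close>

lemma higher_deriv_power_series:
  assumes "\<And>z. z \<in> unit_disk \<Longrightarrow> (\<lambda>m. c m * z ^ m) sums f z"
  shows "(deriv ^^ m) f 0 = fact m * c m"
proof -
  have "eventually (\<lambda>z. z \<in> unit_disk) (nhds (0 :: complex))"
    by (intro eventually_nhds_in_open) auto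
  then have "\<forall>\<^sub>F z in nhds 0. (\<lambda>m. fps_nth (Abs_fps c) m * z ^ m) sums f z"
    by eventually_elim (use assms in auto)
  then have "f has_fps_expansion Abs_fps c"
    by (rule has_fps_expansionI)
  then show ?thesis
    using fps_nth_fps_expansion[of f "Abs_fps c" m] by simp
qed

text \<open>Filling the gaps with zero coefficients leaves the sum unchanged and makes results on
  ordinary power series applicable.\<close>

lemma sums_gap_series:
  fixes z :: complex
  assumes "strict_mono n" "(\<lambda>k. a k * z ^ n k) sums s"
  shows "(\<lambda>m. (if m \<in> range n then a (inv n m) else 0) * z ^ m) sums s"
proof -
  have "inj n"
    using assms(1) by (rule strict_mono_imp_inj_on)
  then show ?thesis
    using assms(2) by (subst sums_mono_reindex[OF assms(1), symmetric]) auto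
qed

lemma higher_deriv_gap_series:
  assumes "strict_mono n" "\<And>z. z \<in> unit_disk \<Longrightarrow> (\<lambda>k. a k * z ^ n k) sums f z"
  shows "(deriv ^^ n k) f 0 = fact (n k) * a k"
  using higher_deriv_power_series[OF sums_gap_series[OF assms], of "n k"]
    strict_mono_imp_inj_on[OF assms(1)] by simp

lemma gap_series_holomorphic:
  assumes "strict_mono n" "\<And>z. z \<in> unit_disk \<Longrightarrow> (\<lambda>k. a k * z ^ n k) sums f z"
  shows "f holomorphic_on unit_disk"
proof (rule power_series_holomorphic)
  fix z assume "z \<in> unit_disk"
  then show "(\<lambda>m. (if m \<in> range n then a (inv n m) else 0) * (z - 0) ^ m) sums f z"
    using sums_gap_series[OF assms(1) assms(2)] by simp
qed

section \<open>Coefficient bounds from Cauchy's inequality\<close>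

lemma half_le_power:
  assumes "m > 0"
  shows "1 / 2 \<le> (1 - 1 / (2 * real m)) ^ m"
  using Bernoulli_inequality[of "- 1 / (2 * real m)" m] assms by simp

text \<open>Cauchy's inequality is applied to \<open>deriv f\<close> at order \<open>m - 1\<close>.
  On the chosen circle the Bloch condition bounds \<open>deriv f\<close> by a multiple of
  \<open>m\<close>, and this \<open>m\<close> turns the factorial of \<open>m - 1\<close> into
  \<open>fact m\<close>.\<close>

lemma Bloch_space_coeff_bounded:
  assumes "f \<in> Bloch_space"
  obtains C where "\<And>m. m > 0 \<Longrightarrow> cmod ((deriv ^^ m) f 0 / fact m) \<le> C"
proof -
  have holf: "f holomorphic_on unit_disk"
    using assms by (simp add: Bloch_space_def)
  obtain M where M: "\<And>z. z \<in> unit_disk \<Longrightarrow> (1 - (cmod z)\<^sup>2) * cmod (deriv f z) \<le> M"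
    using assms unfolding Bloch_space_def bdd_above_def by blast
  have M0: "M \<ge> 0"
    using M[of 0] norm_ge_zero[of "deriv f 0"] by (simp del: norm_ge_zero)
  have hold: "deriv f holomorphic_on unit_disk"
    using holf by (rule holomorphic_deriv) auto
  show ?thesis
  proof (rule that)
    fix m :: nat assume "m > 0"
    then obtain l where l: "m = Suc l"
      using gr0_implies_Suc by blast
    define r where "r = 1 - 1 / (2 * real m)"
    have r: "0 < r" "r < 1" "1 - r = 1 / (2 * real m)"
      using \<open>m > 0\<close> by (auto simp: r_def field_simps)
    have "cmod (deriv f z) \<le> 2 * real m * M" if "cmod (0 - z) = r" for z
    proof -
      have "(1 - r) * cmod (deriv f z) \<le> (1 - r\<^sup>2) * cmod (deriv f z)"
        using r(1,2) by (intro mult_right_mono) (auto simp: power2_eq_square mult_left_le)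
      also have "\<dots> \<le> M"
        using M[of z] that r by simp
      finally show ?thesis
        using \<open>m > 0\<close> r by (simp add: field_simps)
    qed
    then have "cmod ((deriv ^^ l) (deriv f) 0) \<le> fact l * (2 * real m * M) / r ^ l"
      using r hold by (intro Cauchy_inequality)
        (auto intro!: holomorphic_on_imp_continuous_on elim: holomorphic_on_subset)
    also have "\<dots> = fact m * (2 * M / r ^ l)"
      by (simp add: l algebra_simps)
    also have "\<dots> \<le> fact m * (2 * M / (1 / 2))"
    proof -
      have "1 / 2 \<le> r ^ m"
        unfolding r_def using \<open>m > 0\<close> by (rule half_le_power)
      also have "\<dots> \<le> r ^ l"
        using r by (intro power_decreasing) (auto simp: l)
      finally show ?thesis
        using M0 r by (intro mult_left_mono divide_left_mono) auto
    qed
    finally have "cmod ((deriv ^^ m) f 0) \<le> fact m * (4 * M)"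
      by (simp add: l funpow_Suc_right del: funpow.simps fact_Suc)
    then show "cmod ((deriv ^^ m) f 0 / fact m) \<le> 4 * M"
      by (simp add: norm_divide divide_le_eq mult.commute)
  qed
qed

lemma X0_space_eventually_less:
  assumes "f \<in> X0_space" "e > 0"
  obtains b where "b < 1"
    "\<And>z. b < cmod z \<Longrightarrow> cmod z < 1 \<Longrightarrow> cmod (f z) * inverse (A1_norm (bergman_kernel z)) < e"
proof -
  have "((\<lambda>z. cmod (f z) * inverse (A1_norm (bergman_kernel z))) \<longlongrightarrow> 0) (filtercomap cmod (at_left 1))"
    using assms(1) by (simp add: X0_space_def)
  then have "\<forall>\<^sub>F z in filtercomap cmod (at_left 1). cmod (f z) * inverse (A1_norm (bergman_kernel z)) < e"
    using order_tendstoD(2) assms(2) by blast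
  then obtain Q where Q: "eventually Q (at_left (1 :: real))"
    "\<And>z. Q (cmod z) \<Longrightarrow> cmod (f z) * inverse (A1_norm (bergman_kernel z)) < e"
    unfolding eventually_filtercomap by blast
  from Q(1) obtain b :: real where "b < 1" "\<And>y. y > b \<Longrightarrow> y < 1 \<Longrightarrow> Q y"
    using eventually_at_left[of 0 "1 :: real" Q] by auto
  then show ?thesis
    using Q(2) that by blast
qed

lemma X0_space_coeff_tendsto:
  assumes f: "f \<in> X0_space"
  shows "(\<lambda>m. cmod ((deriv ^^ m) f 0 / fact m) / ln (real m)) \<longlonglongrightarrow> 0"
proof (rule LIMSEQ_I)
  fix e :: real assume "e > 0"
  have holf: "f holomorphic_on unit_disk"
    using f by (simp add: X0_space_def X_space_def)
  \<comment> \<open>512 is 4 * 128: the kernel norm on the circle will be at most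
    \<open>128 * ln (real m)\<close>, and Cauchy's inequality costs a further factor 2, which leaves
    e/2.\<close>
  obtain b where b: "b < 1" "\<And>z. b < cmod z \<Longrightarrow> cmod z < 1 \<Longrightarrow>
      cmod (f z) * inverse (A1_norm (bergman_kernel z)) < e / 512"
    using X0_space_eventually_less[OF f, of "e / 512"] \<open>e > 0\<close> by auto
  obtain N where N: "1 / (1 - b) < real N"
    using reals_Archimedean2 by blast
  show "\<exists>N. \<forall>m\<ge>N. norm (cmod ((deriv ^^ m) f 0 / fact m) / ln (real m) - 0) < e"
  proof (intro exI allI impI)
    \<comment> \<open>The summand 2 guarantees that \<open>ln (real m)\<close> is positive and that
      \<open>log 2 (real m)\<close> is at least 1, so additive constants can be absorbed;
      \<open>N\<close> pushes the circle beyond radius \<open>b\<close>.\<close>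
    fix m assume "m \<ge> N + 2"
    then have m: "m \<ge> 2" "1 / (1 - b) < real m"
      using N by linarith+
    define r where "r = 1 - 1 / (2 * real m)"
    have r: "1 / 2 \<le> r" "r < 1" "1 - r = 1 / (2 * real m)"
      using m by (auto simp: r_def field_simps)
    have "1 / real m < 1 - b"
      using m b by (simp add: field_simps)
    then have br: "b < r"
      using m by (simp add: r_def field_simps)
    have lnm: "ln (real m) > 0"
      using m by simp
    \<comment> \<open>Chosen so that \<open>2 ^ K\<close> is at least \<open>2 * real m\<close>, the
      reciprocal of \<open>1 - r\<close>. Then K + 1 is below 3 + \<open>log 2 (real m)\<close>,
      hence at most four times that logarithm, hence at most \<open>8 * ln (real m)\<close>.\<close>
    define K where "K = nat \<lceil>log 2 (2 * real m)\<rceil>"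
    have log2m: "log 2 (2 * real m) = 1 + log 2 (real m)"
      using m by (simp add: log_mult)
    have log_ge: "1 \<le> log 2 (real m)"
      using m by (simp add: le_log_iff)
    have K: "log 2 (2 * real m) \<le> real K" "real K < log 2 (2 * real m) + 1"
      using log_ge log2m by (auto simp: K_def) linarith+
    have "2 * real m \<le> 2 ^ K"
      using K(1) m by (simp add: log_le_iff powr_realpow)
    then have K1: "1 \<le> 2 ^ K * (1 - r)"
      unfolding r(3) using m by (simp add: field_simps)
    have "log 2 (real m) = ln (real m) / ln 2"
      by (simp add: log_def)
    also have "\<dots> \<le> ln (real m) / (1 / 2)"
      using lnm ln2_ge_two_thirds by (intro divide_left_mono) auto
    finally have "log 2 (real m) \<le> 2 * ln (real m)"
      by simp
    then have "16 * (real K + 1) \<le> 128 * ln (real m)"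
      using K(2) log_ge unfolding log2m by argo
    have fle: "cmod (f z) \<le> e / 4 * ln (real m)" if "cmod (0 - z) = r" for z
    proof -
      have z: "z \<in> unit_disk" "cmod z = r"
        using that r by auto
      have A: "A1_norm (bergman_kernel z) > 0"
        using A1_norm_bergman_kernel_ge[OF z(1)] by linarith
      have "cmod (f z) \<le> e / 512 * A1_norm (bergman_kernel z)"
        using b(2)[of z] z br r A by (simp add: field_simps)
      also have "\<dots> \<le> e / 512 * (16 * (real K + 1))"
        using A1_norm_bergman_kernel_le[of z K] z r K1 \<open>e > 0\<close> by (intro mult_left_mono) auto
      also have "\<dots> \<le> e / 512 * (128 * ln (real m))"
        using \<open>e > 0\<close> \<open>16 * (real K + 1) \<le> 128 * ln (real m)\<close> by (intro mult_left_mono) auto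
      finally show ?thesis
        by simp
    qed
    have "cmod ((deriv ^^ m) f 0) \<le> fact m * (e / 4 * ln (real m)) / r ^ m"
      using r holf fle by (intro Cauchy_inequality)
        (auto intro!: holomorphic_on_imp_continuous_on elim: holomorphic_on_subset)
    also have "\<dots> \<le> fact m * (e / 4 * ln (real m)) / (1 / 2)"
      using half_le_power[of m] m lnm \<open>e > 0\<close> r
      by (intro divide_left_mono) (auto simp: r_def)
    finally have "cmod ((deriv ^^ m) f 0 / fact m) \<le> e / 2 * ln (real m)"
      by (simp add: norm_divide divide_le_eq mult_ac)
    also have "\<dots> < e * ln (real m)"
      using lnm \<open>e > 0\<close> by simp
    finally show "norm (cmod ((deriv ^^ m) f 0 / fact m) / ln (real m) - 0) < e"
      using lnm by (simp add: divide_less_eq norm_divide mult_ac)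
  qed
qed

section \<open>A logarithmic growth criterion for membership in \<open>X0_space\<close>\<close>

lemma X0_spaceI:
  assumes holf: "f holomorphic_on unit_disk"
    and growth: "\<And>e. e > 0 \<Longrightarrow> \<exists>M. \<forall>z\<in>unit_disk. cmod (f z) \<le> M - e * ln (1 - cmod z)"
  shows "f \<in> X0_space"
proof -
  define g where "g z = cmod (f z) * inverse (A1_norm (bergman_kernel z))" for z
  have A: "1 / 4 \<le> A1_norm (bergman_kernel z)" if "z \<in> unit_disk" for z
    by (rule A1_norm_bergman_kernel_ge[OF that])
  have small: "\<exists>b<1. \<forall>z. b < cmod z \<longrightarrow> cmod z < 1 \<longrightarrow> g z < d" if "d > 0" for d
  proof -
    obtain M where M: "\<And>z. z \<in> unit_disk \<Longrightarrow> cmod (f z) \<le> M - d / 200 * ln (1 - cmod z)"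
      using growth[of "d / 200"] \<open>d > 0\<close> by (meson divide_pos_pos zero_less_numeral)
    show ?thesis
    proof (intro exI conjI allI impI)
      \<comment> \<open>Of the \<open>d / 100\<close> allowed by the kernel bound, one half goes to
        the logarithmic term. The other half absorbs \<open>M\<close> once
        \<open>- ln (1 - cmod z)\<close> exceeds \<open>200 * M / d\<close>, which is what this
        radius ensures.\<close>
      show "max (1 / 2) (1 - exp (- (200 * M / d))) < 1"
        by simp
      fix z assume z: "max (1 / 2) (1 - exp (- (200 * M / d))) < cmod z" "cmod z < 1"
      then have zD: "z \<in> unit_disk" "1 / 2 \<le> cmod z"
        by auto
      have "ln (1 - cmod z) < ln (exp (- (200 * M / d)))"
        using z by (intro ln_less_cancel_iff[THEN iffD2]) auto
      then have "200 * M / d < - ln (1 - cmod z)"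
        by simp
      then have "M < d / 200 * (- ln (1 - cmod z))"
        using \<open>d > 0\<close> by (simp add: field_simps)
      then have "cmod (f z) < d * (- ln (1 - cmod z) / 100)"
        using M[OF zD(1)] by (simp add: field_simps)
      also have "\<dots> \<le> d * A1_norm (bergman_kernel z)"
        using A1_norm_bergman_kernel_ge_ln[OF zD] \<open>d > 0\<close> by (intro mult_left_mono) auto
      finally show "g z < d"
        using A[OF zD(1)] by (simp add: g_def field_simps)
    qed
  qed
  have "bdd_above (g ` unit_disk)"
  proof -
    obtain b where b: "b < 1" "\<And>z. b < cmod z \<Longrightarrow> cmod z < 1 \<Longrightarrow> g z < 1"
      using small[of 1] by auto
    have "compact (f ` cball 0 b)"
      using holf b(1) by (intro compact_continuous_image holomorphic_on_imp_continuous_on)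
        (auto intro: holomorphic_on_subset)
    then obtain B where B: "\<And>z. z \<in> cball 0 b \<Longrightarrow> cmod (f z) \<le> B"
      using compact_imp_bounded bounded_iff by (metis imageI)
    \<comment> \<open>Near the boundary the limit gives the bound 1; on the compact rest
      \<open>f\<close> is bounded and the reciprocal norm is at most 4.\<close>
    have "g z \<le> max 1 (B * 4)" if z: "z \<in> unit_disk" for z
    proof (cases "b < cmod z")
      case True
      then show ?thesis
        using b(2)[of z] z by auto
    next
      case False
      then have "cmod (f z) \<le> B"
        using B by auto
      moreover have "inverse (A1_norm (bergman_kernel z)) \<le> inverse (1 / 4)"
        using A[OF z] by (intro le_imp_inverse_le) auto
      ultimately have "g z \<le> B * inverse (1 / 4)"
        unfolding g_def using A[OF z] order_trans[OF norm_ge_zero \<open>cmod (f z) \<le> B\<close>]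
        by (intro mult_mono) auto
      then show ?thesis
        by simp
    qed
    then show ?thesis
      by (intro bdd_aboveI2)
  qed
  moreover have "(g \<longlongrightarrow> 0) (filtercomap cmod (at_left 1))"
  proof (rule tendstoI)
    fix d :: real assume "d > 0"
    then obtain b where b: "b < 1" "\<And>z. b < cmod z \<Longrightarrow> cmod z < 1 \<Longrightarrow> g z < d"
      using small by blast
    have "eventually (\<lambda>x. b < x \<and> x < 1) (at_left (1 :: real))"
      using b(1) eventually_at_left[of 0 "1 :: real"] by auto
    moreover have "dist (g z) 0 < d" if "b < cmod z \<and> cmod z < 1" for z
      using b(2)[of z] that A[of z] by (simp add: g_def)
    ultimately show "\<forall>\<^sub>F z in filtercomap cmod (at_left 1). dist (g z) 0 < d"
      unfolding eventually_filtercomap by blast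
  qed
  ultimately show ?thesis
    using holf unfolding X0_space_def X_space_def g_def by blast
qed

section \<open>Lacunary logarithmic sums compared with the series of
  \<open>- ln (1 - r)\<close>\<close>

lemma ln_diff_le_sum_inverse:
  assumes "1 \<le> p" "p \<le> q"
  shows "ln (real q) - ln (real p) \<le> (\<Sum>j\<in>{p..<q}. 1 / real j)"
  using assms(2)
proof (induction q rule: dec_induct)
  case (step q)
  then have q: "real q > 0"
    using assms(1) by simp
  then have "ln (real (Suc q)) - ln (real q) = ln (real (Suc q) / real q)"
    by (intro ln_divide_pos[symmetric]) auto
  also have "real (Suc q) / real q = 1 + 1 / real q"
    using q by (simp add: field_simps)
  also have "ln (1 + 1 / real q) \<le> 1 / real q"
    using q by (intro ln_add_one_self_le_self) auto
  finally show ?case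
    using step by simp
qed simp

lemma ln_diff_mult_power_le:
  fixes r :: real
  assumes "1 \<le> p" "p \<le> q" "0 \<le> r" "r \<le> 1"
  shows "(ln (real q) - ln (real p)) * r ^ q \<le> (\<Sum>j\<in>{p..<q}. r ^ j / real j)"
proof -
  have "(ln (real q) - ln (real p)) * r ^ q \<le> (\<Sum>j\<in>{p..<q}. 1 / real j) * r ^ q"
    using ln_diff_le_sum_inverse[OF assms(1,2)] assms(3) by (intro mult_right_mono) auto
  also have "\<dots> = (\<Sum>j\<in>{p..<q}. r ^ q / real j)"
    by (simp add: sum_distrib_right)
  also have "\<dots> \<le> (\<Sum>j\<in>{p..<q}. r ^ j / real j)"
    using assms by (intro sum_mono divide_right_mono power_decreasing) auto
  finally show ?thesis .
qed

lemma sum_power_div_le_ln: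
  fixes r :: real
  assumes "0 \<le> r" "r < 1"
  shows "(\<Sum>j\<in>{1..<m}. r ^ j / real j) \<le> - ln (1 - r)"
proof -
  \<comment> \<open>The term at \<open>j = 0\<close> is a division by zero and so has value 0; the
    series effectively starts at 1.\<close>
  have "(\<lambda>j. - (r ^ j / real j)) sums ln (1 - r)"
    using ln_series'[of "- r"] assms by simp
  then have "(\<lambda>j. r ^ j / real j) sums - ln (1 - r)"
    using sums_minus by fastforce
  then have "summable (\<lambda>j. r ^ j / real j)" "(\<Sum>j. r ^ j / real j) = - ln (1 - r)"
    by (simp_all add: sums_iff)
  moreover have "(\<Sum>j\<in>{1..<m}. r ^ j / real j) \<le> (\<Sum>j. r ^ j / real j)"
    using calculation(1) assms(1) by (intro sum_le_suminf) auto
  ultimately show ?thesis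
    by simp
qed

text \<open>The intervals between successive exponents are disjoint, so the blocks of
  \<open>r ^ j / real j\<close> that dominate the individual terms add up to one initial sum of the
  logarithmic series.\<close>

lemma sum_ln_mult_power_le:
  fixes r :: real
  assumes n: "\<And>k. n k > 0" "mono n" and \<alpha>: "\<alpha> > 1" "\<And>k. real (n k) powr \<alpha> \<le> real (n (Suc k))"
    and r: "0 \<le> r" "r < 1"
  shows "(\<Sum>k\<le>N. ln (real (n k)) * r ^ n k) \<le> \<alpha> / (\<alpha> - 1) * - ln (1 - r)"
proof -
  define C where "C = \<alpha> / (\<alpha> - 1)"
  have C: "1 \<le> C"
    using \<alpha>(1) by (simp add: C_def)
  have "(\<Sum>k\<le>N. ln (real (n k)) * r ^ n k) \<le> C * (\<Sum>j\<in>{1..<n N}. r ^ j / real j)"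
  proof (induction N)
    case 0
    have "ln (real (n 0)) * r ^ n 0 \<le> 1 * (\<Sum>j\<in>{1..<n 0}. r ^ j / real j)"
      using ln_diff_mult_power_le[of 1 "n 0" r] n(1)[of 0] r by simp
    also have "\<dots> \<le> C * (\<Sum>j\<in>{1..<n 0}. r ^ j / real j)"
      using C r by (intro mult_right_mono sum_nonneg) auto
    finally show ?case
      by simp
  next
    case (Suc N)
    have le: "n N \<le> n (Suc N)"
      using n(2) by (simp add: mono_def)
    have pos: "real (n N) > 0" "real (n (Suc N)) > 0"
      using n(1) by auto
    have "\<alpha> * ln (real (n N)) = ln (real (n N) powr \<alpha>)"
      by (simp add: ln_powr)
    also have "\<dots> \<le> ln (real (n (Suc N)))"
      using \<alpha>(2)[of N] pos by (intro ln_le_cancel_iff[THEN iffD2]) auto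
    finally have "\<alpha> * ln (real (n N)) \<le> ln (real (n (Suc N)))" .
    \<comment> \<open>The gap condition makes \<open>ln (n N)\<close> at most the fraction
      1/\<alpha> of \<open>ln (n (Suc N))\<close>, so the difference keeps at least the fraction
      (\<alpha> - 1)/\<alpha>, whose reciprocal is \<open>C\<close>.\<close>
    then have "ln (real (n (Suc N))) \<le> C * (ln (real (n (Suc N))) - ln (real (n N)))"
      using \<alpha>(1) by (simp add: C_def field_simps)
    then have "ln (real (n (Suc N))) * r ^ n (Suc N)
        \<le> C * (ln (real (n (Suc N))) - ln (real (n N))) * r ^ n (Suc N)"
      using r by (intro mult_right_mono) auto
    also have "\<dots> = C * ((ln (real (n (Suc N))) - ln (real (n N))) * r ^ n (Suc N))"
      by simp
    also have "\<dots> \<le> C * (\<Sum>j\<in>{n N..<n (Suc N)}. r ^ j / real j)"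
      using ln_diff_mult_power_le[of "n N" "n (Suc N)" r] n(1)[of N] r le C
      by (intro mult_left_mono) auto
    finally have "(\<Sum>k\<le>Suc N. ln (real (n k)) * r ^ n k)
        \<le> C * ((\<Sum>j\<in>{1..<n N}. r ^ j / real j) + (\<Sum>j\<in>{n N..<n (Suc N)}. r ^ j / real j))"
      using Suc by (simp add: distrib_left)
    also have "\<dots> = C * (\<Sum>j\<in>{1..<n (Suc N)}. r ^ j / real j)"
      using n(1)[of N] le by (subst sum.atLeastLessThan_concat) auto
    finally show ?case .
  qed
  also have "\<dots> \<le> C * - ln (1 - r)"
    using sum_power_div_le_ln[OF r] C by (intro mult_left_mono) auto
  finally show ?thesis
    by (simp add: C_def)
qed

text \<open>A finite head of the series contributes a constant, and the tail, with coefficients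
  small relative to \<open>ln (n k)\<close>, a small multiple of \<open>- ln (1 - cmod z)\<close>;
  this is the growth that \<open>X0_spaceI\<close> asks for.\<close>

lemma gap_series_in_X0_space:
  assumes n: "strict_mono n" "\<And>k. n k > 0"
    and \<alpha>: "\<alpha> > 1" "\<And>k. real (n k) powr \<alpha> \<le> real (n (Suc k))"
    and f: "\<And>z. z \<in> unit_disk \<Longrightarrow> (\<lambda>k. a k * z ^ n k) sums f z"
    and a: "(\<lambda>k. cmod (a k) / ln (real (n k))) \<longlonglongrightarrow> 0"
  shows "f \<in> X0_space"
proof (rule X0_spaceI)
  show "f holomorphic_on unit_disk"
    using n(1) f by (rule gap_series_holomorphic)
  fix e :: real assume "e > 0"
  define C where "C = \<alpha> / (\<alpha> - 1)"
  have C: "C > 0"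
    using \<alpha>(1) by (simp add: C_def)
  have "\<forall>\<^sub>F k in sequentially. cmod (a k) / ln (real (n k)) < e / C"
    using order_tendstoD(2)[OF a, of "e / C"] C \<open>e > 0\<close> by simp
  then obtain N0 where N0: "\<And>k. k \<ge> N0 \<Longrightarrow> cmod (a k) / ln (real (n k)) < e / C"
    by (auto simp: eventually_sequentially)
  \<comment> \<open>The shift by 1 excludes \<open>k = 0\<close>, where \<open>n 0 = 1\<close> is
    possible; then the quotient by \<open>ln 1\<close> would be 0 by convention and say nothing
    about \<open>a 0\<close>.\<close>
  define K where "K = N0 + 1"
  have large: "cmod (a k) \<le> e / C * ln (real (n k))" if "k \<ge> K" for k
  proof -
    have "n 0 < n k"
      using n(1) that by (simp add: strict_mono_def K_def)
    then have "n k > 1"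
      using n(2)[of 0] by linarith
    then have "ln (real (n k)) > 0"
      by simp
    then show ?thesis
      using N0[of k] that by (simp add: K_def divide_less_eq)
  qed
  have lnn: "ln (real (n k)) \<ge> 0" for k
    using n(2)[of k] by simp
  define M where "M = (\<Sum>k<K. cmod (a k))"
  have "cmod (f z) \<le> M - e * ln (1 - cmod z)" if z: "z \<in> unit_disk" for z
  proof -
    define r where "r = cmod z"
    have r: "0 \<le> r" "r < 1"
      using z by (auto simp: r_def)
    have term_le: "cmod (a k * z ^ n k) \<le> (if k < K then cmod (a k) else 0) + e / C * (ln (real (n k)) * r ^ n k)" for k
    proof (cases "k < K")
      case True
      have "cmod (a k * z ^ n k) \<le> cmod (a k)"
        using r by (simp add: norm_mult norm_power r_def mult_left_le power_le_one)
      moreover have "0 \<le> e / C * (ln (real (n k)) * r ^ n k)"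
        using \<open>e > 0\<close> C lnn r by simp
      ultimately show ?thesis
        using True by simp
    next
      case False
      then have "cmod (a k) * r ^ n k \<le> e / C * ln (real (n k)) * r ^ n k"
        using large r by (intro mult_right_mono) auto
      then show ?thesis
        using False by (simp add: norm_mult norm_power r_def mult.assoc)
    qed
    have partial_le: "cmod (\<Sum>k\<le>N. a k * z ^ n k) \<le> M - e * ln (1 - r)" for N
    proof -
      have "cmod (\<Sum>k\<le>N. a k * z ^ n k)
          \<le> (\<Sum>k\<le>N. (if k < K then cmod (a k) else 0) + e / C * (ln (real (n k)) * r ^ n k))"
        by (intro sum_norm_le term_le)
      also have "\<dots> = (\<Sum>k\<le>N. if k < K then cmod (a k) else 0) + e / C * (\<Sum>k\<le>N. ln (real (n k)) * r ^ n k)"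
        by (simp add: sum.distrib sum_distrib_left)
      also have "(\<Sum>k\<le>N. if k < K then cmod (a k) else 0) = (\<Sum>k\<in>{k\<in>{..N}. k < K}. cmod (a k))"
        by (rule sum.inter_filter[symmetric]) simp
      also have "\<dots> \<le> M"
        unfolding M_def by (intro sum_mono2) auto
      also have "e / C * (\<Sum>k\<le>N. ln (real (n k)) * r ^ n k) \<le> e / C * (C * - ln (1 - r))"
        unfolding C_def
        using \<open>e > 0\<close> C n \<alpha> r strict_mono_mono
        by (intro mult_left_mono sum_ln_mult_power_le) (auto simp: C_def)
      also have "\<dots> = - e * ln (1 - r)"
        using C by simp
      finally show ?thesis
        by simp
    qed
    have "(\<lambda>N. \<Sum>k\<le>N. a k * z ^ n k) \<longlonglongrightarrow> f z"
      using f[OF z] by (simp add: sums_def_le)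
    then have "(\<lambda>N. cmod (\<Sum>k\<le>N. a k * z ^ n k)) \<longlonglongrightarrow> cmod (f z)"
      by (rule tendsto_norm)
    then show ?thesis
      using partial_le by (auto intro: LIMSEQ_le_const2 simp: r_def)
  qed
  then show "\<exists>M. \<forall>z\<in>unit_disk. cmod (f z) \<le> M - e * ln (1 - cmod z)"
    by blast
qed

section \<open>The separating example and the final statement\<close>

lemma X0_space_not_subset_Bloch_space: "\<not> X0_space \<subseteq> Bloch_space"
proof
  assume sub: "X0_space \<subseteq> Bloch_space"
  \<comment> \<open>Each exponent is the square of the previous one, so the gap condition holds with
    \<alpha> = 2. As \<open>ln (n k)\<close> is \<open>2 ^ k * ln 2\<close>, the coefficients
    \<open>k\<close> are negligible against it and yet unbounded.\<close>
  define n :: "nat \<Rightarrow> nat" where "n k = 2 ^ 2 ^ k" for k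
  define f :: "complex \<Rightarrow> complex" where "f z = (\<Sum>k. of_nat k * z ^ n k)" for z
  have n: "strict_mono n" "\<And>k. n k > 0"
    by (auto simp: n_def strict_mono_Suc_iff)
  have nk: "k \<le> n k" for k
    using n(1) by (rule strict_mono_imp_increasing)
  have f: "(\<lambda>k. of_nat k * z ^ n k) sums f z" if "z \<in> unit_disk" for z
  proof -
    have "summable (\<lambda>k. of_nat k * z ^ n k)"
    proof (rule summable_comparison_test')
      \<comment> \<open>The majorant is the derivative of the geometric series, with terms
        \<open>real (Suc k) * cmod z ^ k\<close>.\<close>
      show "summable (\<lambda>k. diffs (\<lambda>_. 1) k * cmod z ^ k)"
        using that by (intro termdiff_converges[where K = 1]) (auto intro: summable_geometric)
      fix k :: nat
      have "real k * cmod z ^ n k \<le> real (Suc k) * cmod z ^ k"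
        using that nk by (intro mult_mono power_decreasing) auto
      then show "norm (of_nat k * z ^ n k) \<le> diffs (\<lambda>_. 1) k * cmod z ^ k"
        by (simp add: norm_mult norm_power diffs_def)
    qed
    then show ?thesis
      by (simp add: f_def summable_sums)
  qed
  have "f \<in> X0_space"
  proof (rule gap_series_in_X0_space[OF n _ _ f])
    fix k
    have "n (Suc k) = (n k)\<^sup>2"
      by (simp add: n_def power_mult[symmetric])
    then show "real (n k) powr 2 \<le> real (n (Suc k))"
      using n(2)[of k] by simp
  next
    have "(\<lambda>k. real k / 2 ^ k / ln 2) \<longlonglongrightarrow> 0"
      by real_asymp
    then show "(\<lambda>k. cmod (of_nat k) / ln (real (n k))) \<longlonglongrightarrow> 0"
      by (simp add: n_def ln_realpow)
  qed simp
  then have "f \<in> Bloch_space"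
    using sub by blast
  then obtain C where C: "\<And>m. m > 0 \<Longrightarrow> cmod ((deriv ^^ m) f 0 / fact m) \<le> C"
    using Bloch_space_coeff_bounded by blast
  have "real k \<le> C" for k
    using C[OF n(2)[of k]] higher_deriv_gap_series[OF n(1) f, of k] by simp
  then show False
    using reals_Archimedean2 by (metis not_le)
qed

theorem theorem2p2:
  "(\<forall>(f :: complex \<Rightarrow> complex) (a :: nat \<Rightarrow> complex) (n :: nat \<Rightarrow> nat).
      f holomorphic_on unit_disk \<longrightarrow>
      (\<forall>z\<in>unit_disk. (\<lambda>k. a k * z ^ n k) sums f z) \<longrightarrow>
      strict_mono n \<longrightarrow>
      (\<forall>k. n k > 0) \<longrightarrow>
      (\<exists>\<alpha> \<beta> :: real. \<alpha> > 1 \<and> \<beta> > 1 \<and>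
         (\<forall>k. real (n k) powr \<alpha> \<le> real (n (Suc k)) \<and>
              real (n (Suc k)) \<le> real (n k) powr (\<alpha> * \<beta>))) \<longrightarrow>
      (f \<in> X0_space \<longleftrightarrow> (\<lambda>k. cmod (a k) / ln (real (n k))) \<longlonglongrightarrow> 0)) \<and>
   \<not> X0_space \<subseteq> Bloch_space"
proof (intro conjI allI impI)
  fix f :: "complex \<Rightarrow> complex" and a :: "nat \<Rightarrow> complex" and n :: "nat \<Rightarrow> nat"
  assume f: "\<forall>z\<in>unit_disk. (\<lambda>k. a k * z ^ n k) sums f z"
    and n: "strict_mono n" "\<forall>k. n k > 0"
    and gaps: "\<exists>\<alpha> \<beta> :: real. \<alpha> > 1 \<and> \<beta> > 1 \<and>
         (\<forall>k. real (n k) powr \<alpha> \<le> real (n (Suc k)) \<and>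
              real (n (Suc k)) \<le> real (n k) powr (\<alpha> * \<beta>))"
  show "f \<in> X0_space \<longleftrightarrow> (\<lambda>k. cmod (a k) / ln (real (n k))) \<longlonglongrightarrow> 0"
  proof
    assume "f \<in> X0_space"
    \<comment> \<open>The limit for all Taylor coefficients is restricted to the subsequence of
      exponents \<open>n k\<close>, where the coefficient is \<open>a k\<close>.\<close>
    then have "(\<lambda>k. cmod ((deriv ^^ n k) f 0 / fact (n k)) / ln (real (n k))) \<longlonglongrightarrow> 0"
      using LIMSEQ_subseq_LIMSEQ[OF X0_space_coeff_tendsto n(1)] by (simp add: o_def)
    then show "(\<lambda>k. cmod (a k) / ln (real (n k))) \<longlonglongrightarrow> 0"
      using higher_deriv_gap_series[OF n(1), of a f] f by simp
  next
    assume "(\<lambda>k. cmod (a k) / ln (real (n k))) \<longlonglongrightarrow> 0"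
    then show "f \<in> X0_space"
      using gaps f n gap_series_in_X0_space[of n _ a f] by blast
  qed
qed (rule X0_space_not_subset_Bloch_space)

end
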